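(* (a) Let $\delta\in\mathbb{R}$. The equation $\alpha^2-\alpha+\frac{\delta}{4}=0$ has: no real solution if $\delta>1$; exactly one real solution, $\alpha=\frac12$, if $\delta=1$; exactly two distinct real solutions, $\frac12\pm\frac{\sqrt{1-\delta}}{2}$, if $\delta<1$. (b) Let $b,c\in\mathbb{R}$ with $b>0$. The equation $x^2-bx+c=0$ has: no real solution if $c>\frac{b^2}{4}$; exactly one real solution, $x=\frac b2$, if $c=\frac{b^2}{4}$; exactly two distinct real solutions, $\frac b2\pm\frac{\sqrt{b^2-4c}}{2}$, if $c<\frac{b^2}{4}$. *)

theory Defs
  imports Complex_Main
begin

end

theory Submission
  imports Defs
begin

text \<open>Completing the square: \<open>4 * (x\<^sup>2 - b * x + c)\<close> equals
  \<open>(2 * x - b)\<^sup>2\<close> minus the discriminant \<open>b\<^sup>2 - 4 * c\<close>, so x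
  is a root exactly when \<open>2 * x - b\<close> is a square root of the discriminant. A real
  number has zero, one or two real square roots according to its sign, which gives the three cases;
  \<open>monic_quadratic_no_root\<close> and \<open>monic_quadratic_roots\<close> carry them. The
  equation in \<alpha> is the instance b = 1, c = \<delta> / 4, whose discriminant is 1 -
  \<delta>.\<close>

lemma monic_quadratic_eq_0_iff:
  fixes b c x :: real
  shows "x\<^sup>2 - b * x + c = 0 \<longleftrightarrow> (2 * x - b)\<^sup>2 = b\<^sup>2 - 4 * c"
proof -
  \<comment> \<open>The factor 4 keeps the completed square free of fractions; being nonzero, it
    does not change the zeros.\<close>
  have "(2 * x - b)\<^sup>2 - (b\<^sup>2 - 4 * c) = 4 * (x\<^sup>2 - b * x + c)"
    by (simp add: power2_eq_square algebra_simps)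
  then show ?thesis
    by (metis eq_iff_diff_eq_0 mult_eq_0_iff zero_neq_numeral)
qed

text \<open>A square cannot equal a negative discriminant.\<close>

lemma monic_quadratic_no_root:
  fixes b c x :: real
  assumes "c > b\<^sup>2 / 4"
  shows "x\<^sup>2 - b * x + c \<noteq> 0"
  using assms zero_le_power2[of "2 * x - b"] unfolding monic_quadratic_eq_0_iff by linarith

text \<open>The bound is not strict, so this also covers the double root, where the two listed
  elements coincide.\<close>

lemma monic_quadratic_roots:
  fixes b c :: real
  assumes "c \<le> b\<^sup>2 / 4"
  shows "{x. x\<^sup>2 - b * x + c = 0} =
    {b / 2 + sqrt (b\<^sup>2 - 4 * c) / 2, b / 2 - sqrt (b\<^sup>2 - 4 * c) / 2}"
proof -
  define s where "s = sqrt (b\<^sup>2 - 4 * c)"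
  \<comment> \<open>The assumption makes the discriminant nonnegative, so \<open>sqrt\<close>
    squares back to it; two squares then agree exactly up to sign.\<close>
  have "b\<^sup>2 - 4 * c = s\<^sup>2"
    using assms by (simp add: s_def)
  then have "x\<^sup>2 - b * x + c = 0 \<longleftrightarrow> 2 * x - b = s \<or> 2 * x - b = - s" for x
    by (simp only: monic_quadratic_eq_0_iff power2_eq_iff)
  moreover have "2 * x - b = s \<longleftrightarrow> x = b / 2 + s / 2"
    and "2 * x - b = - s \<longleftrightarrow> x = b / 2 - s / 2" for x
    by linarith+
  ultimately show ?thesis
    unfolding s_def by auto
qed

lemma monic_quadratic_trichotomy:
  fixes b c :: real
  shows "(c > b\<^sup>2 / 4 \<longrightarrow> \<not> (\<exists>x::real. x\<^sup>2 - b * x + c = 0)) \<and>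
    (c = b\<^sup>2 / 4 \<longrightarrow> {x::real. x\<^sup>2 - b * x + c = 0} = {b / 2}) \<and>
    (c < b\<^sup>2 / 4 \<longrightarrow>
       {x::real. x\<^sup>2 - b * x + c = 0} =
         {b / 2 + sqrt (b\<^sup>2 - 4 * c) / 2, b / 2 - sqrt (b\<^sup>2 - 4 * c) / 2} \<and>
       b / 2 + sqrt (b\<^sup>2 - 4 * c) / 2 \<noteq> b / 2 - sqrt (b\<^sup>2 - 4 * c) / 2)"
proof (intro conjI impI)
  show "\<not> (\<exists>x::real. x\<^sup>2 - b * x + c = 0)" if "c > b\<^sup>2 / 4"
    using monic_quadratic_no_root[OF that] by blast
  show "{x. x\<^sup>2 - b * x + c = 0} = {b / 2}" if "c = b\<^sup>2 / 4"
    \<comment> \<open>The discriminant is now 0, so both roots collapse to b / 2.\<close>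
    using monic_quadratic_roots[of c b] unfolding that by simp
  assume less: "c < b\<^sup>2 / 4"
  show "{x. x\<^sup>2 - b * x + c = 0} =
      {b / 2 + sqrt (b\<^sup>2 - 4 * c) / 2, b / 2 - sqrt (b\<^sup>2 - 4 * c) / 2}"
    using monic_quadratic_roots[of c b] less by simp
  \<comment> \<open>The two roots differ by exactly this square root, so its positivity separates
    them.\<close>
  have "sqrt (b\<^sup>2 - 4 * c) > 0"
    using less by simp
  then show "b / 2 + sqrt (b\<^sup>2 - 4 * c) / 2 \<noteq> b / 2 - sqrt (b\<^sup>2 - 4 * c) / 2"
    by linarith
qed

theorem theorem6:
  shows "(\<forall>\<delta>::real.
      (\<delta> > 1 \<longrightarrow> \<not> (\<exists>\<alpha>::real. \<alpha>\<^sup>2 - \<alpha> + \<delta> / 4 = 0)) \<and>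
      (\<delta> = 1 \<longrightarrow> {\<alpha>::real. \<alpha>\<^sup>2 - \<alpha> + \<delta> / 4 = 0} = {1/2}) \<and>
      (\<delta> < 1 \<longrightarrow>
         {\<alpha>::real. \<alpha>\<^sup>2 - \<alpha> + \<delta> / 4 = 0} =
           {1/2 + sqrt (1 - \<delta>) / 2, 1/2 - sqrt (1 - \<delta>) / 2} \<and>
         1/2 + sqrt (1 - \<delta>) / 2 \<noteq> 1/2 - sqrt (1 - \<delta>) / 2)) \<and>
    (\<forall>b c::real. b > 0 \<longrightarrow>
      (c > b\<^sup>2 / 4 \<longrightarrow> \<not> (\<exists>x::real. x\<^sup>2 - b * x + c = 0)) \<and>
      (c = b\<^sup>2 / 4 \<longrightarrow> {x::real. x\<^sup>2 - b * x + c = 0} = {b / 2}) \<and>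
      (c < b\<^sup>2 / 4 \<longrightarrow>
         {x::real. x\<^sup>2 - b * x + c = 0} =
           {b / 2 + sqrt (b\<^sup>2 - 4 * c) / 2, b / 2 - sqrt (b\<^sup>2 - 4 * c) / 2} \<and>
         b / 2 + sqrt (b\<^sup>2 - 4 * c) / 2 \<noteq> b / 2 - sqrt (b\<^sup>2 - 4 * c) / 2))"
proof (rule conjI; intro allI impI)
  fix \<delta> :: real
  show "(\<delta> > 1 \<longrightarrow> \<not> (\<exists>\<alpha>::real. \<alpha>\<^sup>2 - \<alpha> + \<delta> / 4 = 0)) \<and>
      (\<delta> = 1 \<longrightarrow> {\<alpha>::real. \<alpha>\<^sup>2 - \<alpha> + \<delta> / 4 = 0} = {1/2}) \<and>
      (\<delta> < 1 \<longrightarrow>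
         {\<alpha>::real. \<alpha>\<^sup>2 - \<alpha> + \<delta> / 4 = 0} =
           {1/2 + sqrt (1 - \<delta>) / 2, 1/2 - sqrt (1 - \<delta>) / 2} \<and>
         1/2 + sqrt (1 - \<delta>) / 2 \<noteq> 1/2 - sqrt (1 - \<delta>) / 2)"
    \<comment> \<open>Comparing c with \<open>b\<^sup>2 / 4\<close> becomes comparing \<delta> / 4
      with 1 / 4, that is, \<delta> with 1.\<close>
    using monic_quadratic_trichotomy[where b = 1 and c = "\<delta> / 4"] by simp
qed (rule monic_quadratic_trichotomy)

end
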